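(* Let $\bm p_0,\dots,\bm p_{m-1}$ be distinct points in $\mathbb{R}^d$ whose convex hull $\Omega$ has dimension $d$, and let $\lambda\in(0,1)$. Assume that $S_\lambda=\Omega$ and that there exist $i,k\in\{0,\dots,m-1\}$ such that a vertex of $f_k(\Omega)$ belongs to the interior of $f_i(\Omega)$. Then $\mathcal{L}_d$-almost every $\bm x\in\Omega$ has $2^{\aleph_0}$ distinct addresses, and the exceptional set $V_\lambda$ of those $\bm x\in S_\lambda$ whose set of addresses has cardinality less than $2^{\aleph_0}$ satisfies $\dim_H V_\lambda<d$.
   Context: $f_j(\bm x)=\lambda\bm x+(1-\lambda)\bm p_j$ for $\bm x\in\mathbb{R}^d$, $j=0,\dots,m-1$. The attractor $S_\lambda$ is the unique nonempty compact set with $S_\lambda=\bigcup_{j=0}^{m-1}f_j(S_\lambda)$. An address of $\bm x\in S_\lambda$ is a sequence $(i_1,i_2,\dots)\in\{0,\dots,m-1\}^{\mathbb{N}}$ such that $\bm x=\lim_{n\to\infty}f_{i_1}\cdots f_{i_n}(\bm x_0)$, where $\bm x_0\in\mathbb{R}^d$ is arbitrary (the limit does not depend on $\bm x_0$). $\Omega=\mathrm{conv}(\bm p_0,\dots,\bm p_{m-1})$; $\mathcal{L}_d$ is $d$-dimensional Lebesgue measure; $\dim_H$ is Hausdorff dimension. *)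

theory Defs
  imports "HOL-Analysis.Analysis" "HOL-Library.Equipollence"
begin

section \<open>Hausdorff measure and dimension\<close>

text \<open>The contribution of a covering set \<open>U\<close>, i.e. its diameter to the power \<open>s\<close>, with the
  usual conventions that the empty set contributes \<open>0\<close> and that a nonempty set contributes \<open>1\<close>
  for \<open>s = 0\<close> (whereas \<open>0 powr 0 = 0\<close>).\<close>

definition diam_weight :: "real \<Rightarrow> 'a::metric_space set \<Rightarrow> ennreal" where
  "diam_weight s U =
     (if U = {} then 0 else if s = 0 then 1 else ennreal (diameter U powr s))"

text \<open>Boundedness of the covering sets is required because \<^const>\<open>diameter\<close> is real-valued and
  meaningless on unbounded sets.\<close>

definition hausdorff_premeasure :: "real \<Rightarrow> real \<Rightarrow> 'a::metric_space set \<Rightarrow> ennreal" where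
  "hausdorff_premeasure \<delta> s A =
     (INF U \<in> {U :: nat \<Rightarrow> 'a set.
                 A \<subseteq> (\<Union>n. U n) \<and> (\<forall>n. bounded (U n) \<and> diameter (U n) \<le> \<delta>)}.
        \<Sum>n. diam_weight s (U n))"

definition hausdorff_measure :: "real \<Rightarrow> 'a::metric_space set \<Rightarrow> ennreal" where
  "hausdorff_measure s A = (SUP \<delta> \<in> {0<..}. hausdorff_premeasure \<delta> s A)"

definition hausdorff_dim :: "'a::metric_space set \<Rightarrow> ereal" where
  "hausdorff_dim A = Inf (ereal ` {s. 0 \<le> s \<and> hausdorff_measure s A = 0})"


section \<open>The iterated function system\<close>

text \<open>The points are \<open>p 0, \<dots>, p (m - 1)\<close>; values \<open>p j\<close> with \<open>j \<ge> m\<close> play no role.\<close>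

definition ifs_map :: "real \<Rightarrow> (nat \<Rightarrow> 'a::real_vector) \<Rightarrow> nat \<Rightarrow> 'a \<Rightarrow> 'a" where
  "ifs_map lam p j x = lam *\<^sub>R x + (1 - lam) *\<^sub>R p j"

definition is_attractor ::
    "real \<Rightarrow> (nat \<Rightarrow> 'a::real_normed_vector) \<Rightarrow> nat \<Rightarrow> 'a set \<Rightarrow> bool" where
  "is_attractor lam p m S \<longleftrightarrow>
     S \<noteq> {} \<and> compact S \<and> S = (\<Union>j<m. ifs_map lam p j ` S)"

definition attractor :: "real \<Rightarrow> (nat \<Rightarrow> 'a::real_normed_vector) \<Rightarrow> nat \<Rightarrow> 'a set" where
  "attractor lam p m = (THE S. is_attractor lam p m S)"

definition hull_points :: "(nat \<Rightarrow> 'a::real_vector) \<Rightarrow> nat \<Rightarrow> 'a set" where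
  "hull_points p m = convex hull (p ` {..<m})"

text \<open>\<open>ifs_comp lam p w n\<close> is the composition of the maps with indices \<open>w 0, \<dots>, w (n - 1)\<close>,
  the one with index \<open>w 0\<close> being applied last.\<close>

primrec ifs_comp ::
    "real \<Rightarrow> (nat \<Rightarrow> 'a::real_vector) \<Rightarrow> (nat \<Rightarrow> nat) \<Rightarrow> nat \<Rightarrow> 'a \<Rightarrow> 'a" where
  "ifs_comp lam p w 0 = id"
| "ifs_comp lam p w (Suc n) = ifs_comp lam p w n \<circ> ifs_map lam p (w n)"

definition addresses ::
    "real \<Rightarrow> (nat \<Rightarrow> 'a::real_normed_vector) \<Rightarrow> nat \<Rightarrow> 'a \<Rightarrow> (nat \<Rightarrow> nat) set" where
  "addresses lam p m x =
     {w. (\<forall>n. w n < m) \<and> (\<forall>x0. (\<lambda>n. ifs_comp lam p w n x0) \<longlonglongrightarrow> x)}"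

text \<open>\<open>UNIV :: nat set set\<close> has cardinality \<open>2\<close> to the power aleph-null.\<close>

definition exceptional_set :: "real \<Rightarrow> (nat \<Rightarrow> 'a::real_normed_vector) \<Rightarrow> nat \<Rightarrow> 'a set" where
  "exceptional_set lam p m =
     {x \<in> attractor lam p m. addresses lam p m x \<prec> (UNIV :: nat set set)}"


section \<open>The attractor is well defined\<close>

lemma dist_ifs_map:
  fixes p :: "nat \<Rightarrow> 'a::real_normed_vector"
  assumes "0 \<le> lam"
  shows "dist (ifs_map lam p j x) (ifs_map lam p j y) = lam * dist x y"
proof -
  have "ifs_map lam p j x - ifs_map lam p j y = lam *\<^sub>R (x - y)"
    by (simp add: ifs_map_def algebra_simps)
  then show ?thesis using assms by (simp add: dist_norm)
qed

lemma is_attractor_subset: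
  fixes p :: "nat \<Rightarrow> 'a::euclidean_space"
  assumes lam: "0 < lam" "lam < 1"
    and A: "is_attractor lam p m A" and B: "is_attractor lam p m B"
  shows "A \<subseteq> B"
proof -
  have neA: "A \<noteq> {}" and cA: "compact A" and fA: "A = (\<Union>j<m. ifs_map lam p j ` A)"
    using A by (auto simp: is_attractor_def)
  have neB: "B \<noteq> {}" and cB: "compact B" and fB: "B = (\<Union>j<m. ifs_map lam p j ` B)"
    using B by (auto simp: is_attractor_def)
  have "continuous_on A (\<lambda>x. infdist x B)"
    by (intro continuous_intros)
  then obtain a where a: "a \<in> A" "\<And>y. y \<in> A \<Longrightarrow> infdist y B \<le> infdist a B"
    using continuous_attains_sup[OF cA neA] by blast
  obtain j a' where j: "j < m" "a' \<in> A" "a = ifs_map lam p j a'"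
    using a(1) fA by blast
  obtain b where b: "b \<in> B" "infdist a' B = dist a' b"
    using infdist_attains_inf[OF compact_imp_closed[OF cB] neB] by blast
  have "ifs_map lam p j b \<in> B" using fB b(1) j(1) by blast
  then have "infdist a B \<le> dist a (ifs_map lam p j b)" by (rule infdist_le)
  also have "\<dots> = lam * infdist a' B" using j(3) b(2) lam by (simp add: dist_ifs_map)
  also have "\<dots> \<le> lam * infdist a B" using a(2)[OF j(2)] lam by simp
  finally have "(1 - lam) * infdist a B \<le> 0" by (simp add: algebra_simps)
  then have "infdist a B \<le> 0" using lam by (simp add: mult_le_0_iff)
  then have "infdist y B = 0" if "y \<in> A" for y
    using a(2)[OF that] infdist_nonneg[of y B] by linarith
  then show ?thesis
    using in_closed_iff_infdist_zero[OF compact_imp_closed[OF cB] neB] by blast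
qed

lemma is_attractor_exists:
  fixes p :: "nat \<Rightarrow> 'a::euclidean_space"
  assumes lam: "0 < lam" "lam < 1" and m: "0 < m"
  shows "\<exists>S. is_attractor lam p m S"
proof -
  define F where "F A = (\<Union>j<m. ifs_map lam p j ` A)" for A
  define K where "K n = (F ^^ n) (hull_points p m)" for n
  have K0: "K 0 = hull_points p m" and KS: "K (Suc n) = F (K n)" for n
    by (simp_all add: K_def)
  have mono: "F A \<subseteq> F B" if "A \<subseteq> B" for A B using that by (auto simp: F_def)
  have sub0: "K 1 \<subseteq> K 0"
  proof -
    have "ifs_map lam p j x \<in> hull_points p m" if "j < m" "x \<in> hull_points p m" for j x
      using that lam unfolding ifs_map_def hull_points_def
      by (intro convexD[OF convex_convex_hull]) (auto intro: hull_inc)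
    then show ?thesis by (auto simp: K0 KS F_def)
  qed
  have dec1: "K (Suc n) \<subseteq> K n" for n
  proof (induction n)
    case 0 then show ?case using sub0 by simp
  next
    case (Suc n) then show ?case using mono[OF Suc] by (simp add: KS)
  qed
  then have dec: "K n \<subseteq> K k" if "k \<le> n" for k n
    using that lift_Suc_antimono_le[of K] by blast
  have cont: "continuous_on A (ifs_map lam p j)" for A j
    unfolding ifs_map_def by (intro continuous_intros)
  have cK: "compact (K n) \<and> K n \<noteq> {}" for n
  proof (induction n)
    case 0
    then show ?case using m
      by (auto simp: K0 hull_points_def finite_imp_compact intro: compact_convex_hull)
  next
    case (Suc n)
    have "compact (F (K n))" unfolding F_def
      using Suc by (intro compact_UN compact_continuous_image cont) auto
    moreover have "F (K n) \<noteq> {}" using Suc m by (auto simp: F_def)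
    ultimately show ?case by (simp add: KS)
  qed
  define S where "S = (\<Inter>n. K n)"
  have ne: "S \<noteq> {}" unfolding S_def using cK dec by (intro compact_nest) auto
  have cS: "compact S" unfolding S_def using cK
    by (intro compact_Inter) auto
  have "F S \<subseteq> S"
  proof -
    have "F S \<subseteq> K (Suc n)" for n unfolding KS by (rule mono) (auto simp: S_def)
    then show ?thesis using dec1 unfolding S_def by blast
  qed
  moreover have "S \<subseteq> F S"
  proof
    fix x assume x: "x \<in> S"
    have "\<exists>j<m. \<forall>n. x \<in> ifs_map lam p j ` K n"
    proof (rule ccontr)
      assume "\<not> ?thesis"
      then obtain N where N: "\<And>j. j < m \<Longrightarrow> x \<notin> ifs_map lam p j ` K (N j)" by metis
      define M where "M = Max (N ` {..<m})"
      have "x \<in> F (K M)" using x KS[of M] unfolding S_def by blast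
      then obtain j where j: "j < m" "x \<in> ifs_map lam p j ` K M" unfolding F_def by blast
      have "N j \<le> M" unfolding M_def using j(1) by auto
      then show False using N[OF j(1)] j(2) dec by blast
    qed
    then obtain j where j: "j < m" "\<And>n. x \<in> ifs_map lam p j ` K n" by blast
    obtain y where y: "x = ifs_map lam p j y" using j(2) by blast
    have "y \<in> K n" for n
    proof -
      obtain z where "z \<in> K n" "x = ifs_map lam p j z" using j(2) by blast
      then show ?thesis using y lam by (simp add: ifs_map_def)
    qed
    then show "x \<in> F S" using j(1) y by (auto simp: F_def S_def)
  qed
  ultimately have "S = F S" by blast
  then show ?thesis using ne cS unfolding is_attractor_def F_def by blast
qed

lemma is_attractor_attractor:
  fixes p :: "nat \<Rightarrow> 'a::euclidean_space"
  assumes "0 < lam" "lam < 1" "0 < m"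
  shows "is_attractor lam p m (attractor lam p m)"
proof -
  have "\<exists>!S. is_attractor lam p m S"
    using is_attractor_exists[OF assms] is_attractor_subset[OF assms(1,2)] by blast
  then show ?thesis unfolding attractor_def by (rule theI')
qed

lemma attractor_unique:
  fixes p :: "nat \<Rightarrow> 'a::euclidean_space"
  assumes "0 < lam" "lam < 1" "is_attractor lam p m S"
  shows "attractor lam p m = S"
  unfolding attractor_def
  using assms(3) is_attractor_subset[OF assms(1,2)] by (intro the_equality) blast+

end

theory Submission
  imports Defs
begin

text \<open>
  Write \<open>\<Omega>\<close> for the hull and \<open>f\<^sub>w\<close> for the composition along a finite word \<open>w\<close>. Since \<open>\<Omega>\<close> is
  the attractor, an infinite word is an address of \<open>x\<close> exactly when \<open>x\<close> lies in \<open>f\<^sub>w(\<Omega>)\<close> for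
  each of its finite prefixes \<open>w\<close>, and any finite word leading from \<open>x\<close> to a point of \<open>\<Omega>\<close>
  extends to an address of \<open>x\<close> (\<open>addresses_iff\<close>, \<open>prepend_word_address\<close>).

  \<^bold>\<open>Reduction to unique addresses.\<close> The first description shows that the address set of \<open>x\<close> is
  closed in the Cantor-like space of all words. A nonempty closed set without isolated points
  has the cardinality of the continuum, so if \<open>x\<close> has fewer addresses, one of them is isolated:
  some prefix \<open>w\<close> of it determines it. Then \<open>x = f\<^sub>w(y)\<close> where \<open>y\<close> has exactly one address.
  Hence the exceptional set lies in the union of the countably many sets \<open>f\<^sub>w(U)\<close>, where
  \<open>U\<close>, called \<open>univoque\<close> below, is the set of points with a unique address
  (\<open>few_addresses_imp_univoque_preimage\<close>).

  \<^bold>\<open>Porosity.\<close> A vertex of the convex body \<open>f\<^sub>k(\<Omega>)\<close> is a limit of interior points of it, so if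
  it is an interior point of \<open>f\<^sub>i(\<Omega>)\<close>, then the two interiors meet, and they share a ball \<open>B\<close>.
  Every point of \<open>f\<^sub>w(B)\<close> can be continued after \<open>w\<close> both by \<open>k\<close> and by \<open>i\<close>, so \<open>f\<^sub>w(B)\<close> misses
  \<open>U\<close> for every \<open>w\<close>. Around a point of \<open>U\<close>, a copy \<open>f\<^sub>w(\<Omega>)\<close> of any prescribed
  size contains such a hole of comparable size: \<open>U\<close> is uniformly porous (\<open>porous_univoque\<close>).

  \<^bold>\<open>Dimension.\<close> If every cube contains a hole of a fixed relative size, then on subdividing it
  into \<open>K\<^sup>d\<close> subcubes, \<open>K\<close> large, one of them misses the set. So \<open>(K\<^sup>d - 1)\<^sup>n\<close> cubes of side
  \<open>K\<^sup>-\<^sup>n\<close> suffice up to constants, and the \<open>s\<close>-dimensional measure vanishes as soon as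
  \<open>K\<^sup>s > K\<^sup>d - 1\<close>, which some \<open>s < d\<close> satisfies (\<open>porous_imp_hausdorff_measure_eq_0\<close>).
  Nullity for this \<open>s\<close> passes to the images \<open>f\<^sub>w(U)\<close> and to their countable union, and it implies
  nullity for Lebesgue measure, which gives both claims.
\<close>

section \<open>Null sets of Hausdorff measures\<close>

text \<open>For nullity the mesh size is irrelevant: if the sum of the \<open>s\<close>-th powers of the diameters is at
  most \<open>\<delta> powr s\<close>, then so is each term, and every covering set has diameter at most \<open>\<delta>\<close>.\<close>

lemma hausdorff_measure_eq_0_iff:
  fixes A :: "'a::metric_space set"
  assumes s: "0 < s"
  shows "hausdorff_measure s A = 0 \<longleftrightarrow>
    (\<forall>e>0. \<exists>U :: nat \<Rightarrow> 'a set. A \<subseteq> (\<Union>n. U n) \<and> (\<forall>n. bounded (U n)) \<and>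
       (\<Sum>n. diam_weight s (U n)) \<le> ennreal e)"
    (is "?L \<longleftrightarrow> ?R")
proof
  assume ?L
  then have "hausdorff_premeasure 1 s A = 0"
    unfolding hausdorff_measure_def by (auto simp: bot_ennreal[symmetric] SUP_bot_conv)
  show ?R
  proof (intro allI impI)
    fix e :: real assume "e > 0"
    then have "hausdorff_premeasure 1 s A < ennreal e"
      using \<open>hausdorff_premeasure 1 s A = 0\<close> by simp
    then show "\<exists>U :: nat \<Rightarrow> 'a set. A \<subseteq> (\<Union>n. U n) \<and> (\<forall>n. bounded (U n)) \<and>
       (\<Sum>n. diam_weight s (U n)) \<le> ennreal e"
      unfolding hausdorff_premeasure_def INF_less_iff by (blast intro: less_imp_le)
  qed
next
  assume R: ?R
  have "hausdorff_premeasure \<delta> s A \<le> 0" if \<delta>: "\<delta> > 0" for \<delta>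
  proof (rule ennreal_le_epsilon)
    fix e :: real assume e: "e > 0"
    obtain U :: "nat \<Rightarrow> 'a set" where U: "A \<subseteq> (\<Union>n. U n)" "\<And>n. bounded (U n)"
        "(\<Sum>n. diam_weight s (U n)) \<le> ennreal (min e (\<delta> powr s))"
      using R[rule_format, of "min e (\<delta> powr s)"] e \<delta> by auto
    have "diameter (U n) \<le> \<delta>" for n
    proof (rule ccontr)
      assume neg: "\<not> diameter (U n) \<le> \<delta>"
      then have ne: "U n \<noteq> {}" using \<delta> by (auto simp: diameter_def)
      have "\<delta> powr s < diameter (U n) powr s"
        using neg \<delta> s by (intro powr_less_mono2) auto
      then have "ennreal (\<delta> powr s) < diam_weight s (U n)"
        using ne s by (simp add: diam_weight_def ennreal_less_iff)
      also have "\<dots> \<le> (\<Sum>n. diam_weight s (U n))"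
        using sum_le_suminf[of "\<lambda>n. diam_weight s (U n)" "{n}"] by simp
      also have "\<dots> \<le> ennreal (\<delta> powr s)"
        using U(3) by (rule order_trans) (simp add: ennreal_leI)
      finally show False by simp
    qed
    then have "hausdorff_premeasure \<delta> s A \<le> (\<Sum>n. diam_weight s (U n))"
      unfolding hausdorff_premeasure_def using U by (intro INF_lower) auto
    also have "\<dots> \<le> ennreal e" using U(3) by (rule order_trans) (simp add: ennreal_leI)
    finally show "hausdorff_premeasure \<delta> s A \<le> 0 + ennreal e" by simp
  qed
  then have "hausdorff_measure s A \<le> 0"
    unfolding hausdorff_measure_def by (intro SUP_least) auto
  then show ?L by simp
qed

lemma hausdorff_measure_eq_0_if_finite_covers:
  fixes A :: "'a::metric_space set"
  assumes s: "0 < s"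
    and cov: "\<And>e. e > 0 \<Longrightarrow> \<exists>C \<delta>. finite C \<and> A \<subseteq> \<Union>C \<and>
      (\<forall>B\<in>C. bounded B \<and> diameter B \<le> \<delta>) \<and> real (card C) * \<delta> powr s \<le> e"
  shows "hausdorff_measure s A = 0"
  unfolding hausdorff_measure_eq_0_iff[OF s]
proof (intro allI impI)
  fix e :: real assume "e > 0"
  from cov[OF this] obtain C \<delta> where C: "finite C" "A \<subseteq> \<Union>C"
     and Cb: "\<forall>B\<in>C. bounded B \<and> diameter B \<le> \<delta>" and Ce: "real (card C) * \<delta> powr s \<le> e"
    by (elim exE conjE)
  obtain h where h: "bij_betw h {0..<card C} C"
    using ex_bij_betw_nat_finite[OF C(1)] by blast
  then have hC: "h n \<in> C" if "n < card C" for n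
    using that by (auto simp: bij_betw_def)
  define U where "U n = (if n < card C then h n else {})" for n
  have "A \<subseteq> (\<Union>n. U n)"
  proof
    fix x assume "x \<in> A"
    then obtain B where "B \<in> C" "x \<in> B" using C(2) by blast
    moreover have "B \<in> h ` {0..<card C}"
      using \<open>B \<in> C\<close> by (simp add: bij_betw_imp_surj_on[OF h])
    then obtain n where "n < card C" "B = h n" by auto
    ultimately show "x \<in> (\<Union>n. U n)" by (auto simp: U_def)
  qed
  moreover have "bounded (U n)" for n using Cb hC by (simp add: U_def)
  moreover have "(\<Sum>n. diam_weight s (U n)) \<le> ennreal e"
  proof -
    have "(\<Sum>n. diam_weight s (U n)) = (\<Sum>n<card C. diam_weight s (U n))"
      by (intro suminf_finite) (auto simp: U_def diam_weight_def)
    also have "\<dots> \<le> (\<Sum>n<card C. ennreal (\<delta> powr s))"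
    proof (intro sum_mono)
      fix n assume "n \<in> {..<card C}"
      then have "diameter (h n) \<le> \<delta>" "0 \<le> diameter (h n)"
        using Cb hC by (auto simp: diameter_ge_0)
      then show "diam_weight s (U n) \<le> ennreal (\<delta> powr s)"
        using s by (auto simp: U_def diam_weight_def intro!: ennreal_leI powr_mono2)
    qed
    also have "\<dots> = ennreal (real (card C) * \<delta> powr s)"
      by (simp add: ennreal_mult ennreal_of_nat_eq_real_of_nat)
    also have "\<dots> \<le> ennreal e" using Ce by (rule ennreal_leI)
    finally show ?thesis .
  qed
  ultimately show "\<exists>U :: nat \<Rightarrow> 'a set. A \<subseteq> (\<Union>n. U n) \<and> (\<forall>n. bounded (U n)) \<and>
       (\<Sum>n. diam_weight s (U n)) \<le> ennreal e" by blast
qed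

lemma hausdorff_measure_eq_0_subset:
  assumes "0 < s" "hausdorff_measure s B = 0" "A \<subseteq> B"
  shows "hausdorff_measure s A = 0"
  using assms(2,3) unfolding hausdorff_measure_eq_0_iff[OF assms(1)] by (meson order_trans)

text \<open>The set with number \<open>k\<close> is covered with total weight \<open>e / 2 ^ (k + 1)\<close>.\<close>

lemma hausdorff_measure_eq_0_UN:
  fixes A :: "nat \<Rightarrow> 'a::metric_space set"
  assumes s: "0 < s" and A: "\<And>k. hausdorff_measure s (A k) = 0"
  shows "hausdorff_measure s (\<Union>k. A k) = 0"
  unfolding hausdorff_measure_eq_0_iff[OF s]
proof (intro allI impI)
  fix e :: real assume e: "e > 0"
  have "\<exists>U :: nat \<Rightarrow> 'a set. A k \<subseteq> (\<Union>n. U n) \<and> (\<forall>n. bounded (U n)) \<and>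
       (\<Sum>n. diam_weight s (U n)) \<le> ennreal (e * (1/2) ^ Suc k)" for k
    using A[of k] e unfolding hausdorff_measure_eq_0_iff[OF s] by simp
  then obtain U where U: "\<And>k. A k \<subseteq> (\<Union>n. U k n)" "\<And>k n. bounded (U k n)"
      "\<And>k. (\<Sum>n. diam_weight s (U k n)) \<le> ennreal (e * (1/2) ^ Suc k)"
    by metis
  define V where "V i = case_prod U (prod_decode i)" for i
  have "(\<Union>k. A k) \<subseteq> (\<Union>i. V i)"
  proof clarify
    fix x k assume "x \<in> A k"
    then obtain n where "x \<in> U k n" using U(1) by blast
    then have "x \<in> V (prod_encode (k, n))" by (simp add: V_def)
    then show "x \<in> (\<Union>i. V i)" by blast
  qed
  moreover have "bounded (V i)" for i using U(2) by (simp add: V_def split: prod.split)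
  moreover have "(\<Sum>i. diam_weight s (V i)) \<le> ennreal e"
  proof -
    have "(\<Sum>i. diam_weight s (V i)) = (\<Sum>k. \<Sum>n. diam_weight s (U k n))"
      using suminf_ennreal_2dimen[where f = "\<lambda>(k, n). diam_weight s (U k n)"]
      by (simp add: V_def case_prod_beta)
    also have "\<dots> \<le> (\<Sum>k. ennreal (e * (1/2) ^ Suc k))"
      using U(3) by (intro suminf_le) auto
    also have "\<dots> = ennreal e"
    proof (rule suminf_ennreal_eq)
      show "(\<lambda>k. e * (1/2) ^ Suc k) sums e"
        using sums_mult[OF power_half_series, of e] by simp
    qed (use e in auto)
    finally show ?thesis .
  qed
  ultimately show "\<exists>U :: nat \<Rightarrow> 'a set. (\<Union>k. A k) \<subseteq> (\<Union>n. U n) \<and> (\<forall>n. bounded (U n)) \<and>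
       (\<Sum>n. diam_weight s (U n)) \<le> ennreal e" by blast
qed

lemma hausdorff_measure_eq_0_image:
  fixes f :: "'a::metric_space \<Rightarrow> 'b::metric_space"
  assumes s: "0 < s" and A: "hausdorff_measure s A = 0"
    and f: "\<And>x y. dist (f x) (f y) \<le> dist x y"
  shows "hausdorff_measure s (f ` A) = 0"
  unfolding hausdorff_measure_eq_0_iff[OF s]
proof (intro allI impI)
  fix e :: real assume e: "e > 0"
  then obtain U :: "nat \<Rightarrow> 'a set" where U: "A \<subseteq> (\<Union>n. U n)" "\<And>n. bounded (U n)"
       "(\<Sum>n. diam_weight s (U n)) \<le> ennreal e"
    using A unfolding hausdorff_measure_eq_0_iff[OF s] by blast
  have bnd: "bounded (f ` U n)" for n
    using U(2)[of n] unfolding bounded_two_points by (blast intro: order_trans f)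
  have "diameter (f ` U n) \<le> diameter (U n)" if ne: "U n \<noteq> {}" for n
  proof -
    have "dist (f x) (f y) \<le> diameter (U n)" if "x \<in> U n" "y \<in> U n" for x y
      using f diameter_bounded_bound[OF U(2) that] by (rule order_trans)
    then show ?thesis using ne unfolding diameter_def[of "f ` U n"]
      by (auto intro!: cSUP_least)
  qed
  then have "diam_weight s (f ` U n) \<le> diam_weight s (U n)" for n
    using s diameter_ge_0[OF bnd] by (auto simp: diam_weight_def intro!: ennreal_leI powr_mono2)
  then have "(\<Sum>n. diam_weight s (f ` U n)) \<le> (\<Sum>n. diam_weight s (U n))"
    by (intro suminf_le) auto
  then have "(\<Sum>n. diam_weight s (f ` U n)) \<le> ennreal e" using U(3) by (rule order_trans)
  moreover have "f ` A \<subseteq> (\<Union>n. f ` U n)" using U(1) by blast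
  ultimately show "\<exists>V :: nat \<Rightarrow> 'b set. f ` A \<subseteq> (\<Union>n. V n) \<and> (\<forall>n. bounded (V n)) \<and>
       (\<Sum>n. diam_weight s (V n)) \<le> ennreal e"
    using bnd by blast
qed

lemma hausdorff_dim_le:
  assumes "0 \<le> s" "hausdorff_measure s A = 0"
  shows "hausdorff_dim A \<le> ereal s"
  unfolding hausdorff_dim_def using assms by (intro Inf_lower) auto

text \<open>A set of diameter \<open>r \<le> 1\<close> lies in a ball of radius \<open>r\<close>, whose volume is a constant times
  \<open>r ^ d \<le> r powr s\<close>; so a cover of small \<open>s\<close>-weight yields one of small volume.\<close>

lemma negligible_if_hausdorff_measure_eq_0:
  fixes A :: "'a::euclidean_space set"
  assumes s: "0 < s" "s \<le> real DIM('a)" and A: "hausdorff_measure s A = 0"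
  shows "negligible A"
  unfolding negligible_outer_le
proof (intro allI impI)
  fix e :: real assume e: "e > 0"
  define c where "c = unit_ball_vol (real DIM('a))"
  have c: "c > 0" by (simp add: c_def)
  \<comment> \<open>The bound \<open>1\<close> forces all diameters to be at most \<open>1\<close>.\<close>
  obtain U :: "nat \<Rightarrow> 'a set" where U: "A \<subseteq> (\<Union>n. U n)" "\<And>n. bounded (U n)"
       "(\<Sum>n. diam_weight s (U n)) \<le> ennreal (min 1 (e / c))"
    using A e c unfolding hausdorff_measure_eq_0_iff[OF s(1)]
    by (metis divide_pos_pos min_less_iff_conj zero_less_one)
  define V where "V n = (if U n = {} then {} else cball (SOME x. x \<in> U n) (diameter (U n)))" for n
  have V: "emeasure lborel (V n) \<le> ennreal c * diam_weight s (U n)" for n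
  proof (cases "U n = {}")
    case False
    have d: "0 \<le> diameter (U n)" using U(2) by (rule diameter_ge_0)
    have "ennreal (diameter (U n) powr s) \<le> (\<Sum>n. diam_weight s (U n))"
      using sum_le_suminf[of "\<lambda>n. diam_weight s (U n)" "{n}"] False s(1)
      by (simp add: diam_weight_def)
    also have "\<dots> \<le> ennreal 1" using U(3) by (rule order_trans) (simp add: ennreal_leI)
    finally have ds: "diameter (U n) powr s \<le> 1" by (simp del: ennreal_1)
    have d1: "diameter (U n) \<le> 1"
    proof (rule ccontr)
      assume "\<not> diameter (U n) \<le> 1"
      then have "1 powr s < diameter (U n) powr s" using s(1) by (intro powr_less_mono2) auto
      then show False using ds by simp
    qed
    have "diameter (U n) ^ DIM('a) \<le> diameter (U n) powr s"
    proof (cases "diameter (U n) = 0")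
      case False
      then have "diameter (U n) ^ DIM('a) = diameter (U n) powr real DIM('a)"
        using d by (simp add: powr_realpow)
      also have "\<dots> \<le> diameter (U n) powr s" using s d d1 False by (intro powr_mono') auto
      finally show ?thesis .
    qed (simp add: zero_power)
    then show ?thesis
      using False d s c by (simp add: V_def diam_weight_def emeasure_cball c_def[symmetric]
        flip: ennreal_mult)
  qed (simp add: V_def)
  define T where "T = (\<Union>n. V n)"
  have Vs: "V n \<in> sets lborel" for n by (simp add: V_def)
  then have T: "T \<in> sets lborel" by (auto simp: T_def)
  have "emeasure lborel T \<le> (\<Sum>n. emeasure lborel (V n))"
    unfolding T_def using Vs by (intro emeasure_subadditive_countably) auto
  also have "\<dots> \<le> (\<Sum>n. ennreal c * diam_weight s (U n))"
    using V by (intro suminf_le) auto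
  also have "\<dots> = ennreal c * (\<Sum>n. diam_weight s (U n))" by simp
  also have "\<dots> \<le> ennreal c * ennreal (e / c)"
    by (intro mult_left_mono order_trans[OF U(3)] ennreal_leI) auto
  also have "\<dots> = ennreal e" using c e by (simp flip: ennreal_mult)
  finally have Te: "emeasure lebesgue T \<le> ennreal e" using T by simp
  have "T \<in> lmeasurable"
    using T Te by (intro fmeasurableI) (auto intro: le_less_trans)
  moreover have "measure lebesgue T \<le> e"
    using Te e by (simp add: measure_def enn2real_leI)
  moreover have "A \<subseteq> T"
  proof
    fix x assume "x \<in> A"
    then obtain n where n: "x \<in> U n" using U(1) by blast
    have "(SOME x. x \<in> U n) \<in> U n" using n by (rule someI)
    then have "x \<in> V n"
      using n diameter_bounded_bound[OF U(2), of "SOME x. x \<in> U n" n x] by (auto simp: V_def)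
    then show "x \<in> T" by (auto simp: T_def)
  qed
  ultimately show "\<exists>T. A \<subseteq> T \<and> T \<in> lmeasurable \<and> measure lebesgue T \<le> e" by blast
qed

section \<open>Porous sets\<close>

definition cube :: "'a::euclidean_space \<Rightarrow> real \<Rightarrow> 'a set" where
  "cube a h = cbox a (a + h *\<^sub>R One)"

text \<open>Only the balls centred in \<open>U\<close> are required to have holes, and the hole may stick out of the ball:
  only its centre has to lie in it.\<close>

definition porous :: "real \<Rightarrow> real \<Rightarrow> 'a::metric_space set \<Rightarrow> bool" where
  "porous c r0 U \<longleftrightarrow>
     (\<forall>x\<in>U. \<forall>r. 0 < r \<and> r \<le> r0 \<longrightarrow> (\<exists>z. dist x z \<le> r \<and> ball z (c * r) \<inter> U = {}))"

lemma mem_cube: "x \<in> cube a h \<longleftrightarrow> (\<forall>b\<in>Basis. 0 \<le> (x - a) \<bullet> b \<and> (x - a) \<bullet> b \<le> h)"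
  unfolding cube_def mem_box by (auto simp: inner_diff_left inner_add_left)

lemma dist_cube_le:
  fixes x :: "'a::euclidean_space"
  assumes "x \<in> cube a h" "y \<in> cube a h"
  shows "dist x y \<le> real DIM('a) * h"
proof -
  have "norm (x - y) \<le> (\<Sum>b\<in>Basis. \<bar>(x - y) \<bullet> b\<bar>)" by (rule norm_le_l1)
  also have "\<dots> \<le> (\<Sum>b\<in>(Basis::'a set). h)"
  proof (rule sum_mono)
    fix b :: 'a assume "b \<in> Basis"
    then show "\<bar>(x - y) \<bullet> b\<bar> \<le> h"
      using assms by (force simp: mem_cube inner_diff_left)
  qed
  finally show ?thesis by (simp add: dist_norm)
qed

definition subcube_corner :: "nat \<Rightarrow> 'a::euclidean_space \<Rightarrow> real \<Rightarrow> ('a \<Rightarrow> nat) \<Rightarrow> 'a" where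
  "subcube_corner K a h g = a + (\<Sum>b\<in>Basis. (real (g b) * (h / real K)) *\<^sub>R b)"

definition subcube_index :: "nat \<Rightarrow> ('a::euclidean_space \<Rightarrow> nat) set" where
  "subcube_index K = (\<Pi>\<^sub>E b\<in>Basis. {..<K})"

lemma finite_subcube_index: "finite (subcube_index K :: ('a::euclidean_space \<Rightarrow> nat) set)"
  unfolding subcube_index_def by (intro finite_PiE) auto

lemma card_subcube_index:
  "card (subcube_index K :: ('a::euclidean_space \<Rightarrow> nat) set) = K ^ DIM('a)"
  unfolding subcube_index_def by (simp add: card_PiE)

text \<open>The subcube of \<open>x\<close> is found by rounding down its coordinates in units of \<open>h / K\<close>; on the far faces
  of the cube this would give the index \<open>K\<close>, which is replaced by \<open>K - 1\<close>.\<close>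

lemma cube_subdivision:
  fixes a :: "'a::euclidean_space"
  assumes "0 < h" "0 < K" "x \<in> cube a h"
  shows "\<exists>g\<in>subcube_index K. x \<in> cube (subcube_corner K a h g) (h / real K)"
proof -
  define \<eta> where "\<eta> = h / real K"
  have \<eta>: "\<eta> > 0" and h: "h = real K * \<eta>" using assms by (auto simp: \<eta>_def)
  define g :: "'a \<Rightarrow> nat" where
    "g = (\<lambda>b\<in>Basis. min (K - 1) (nat \<lfloor>((x - a) \<bullet> b) / \<eta>\<rfloor>))"
  have "g \<in> subcube_index K" using assms(2) by (auto simp: subcube_index_def g_def)
  moreover have "0 \<le> (x - subcube_corner K a h g) \<bullet> b \<and> (x - subcube_corner K a h g) \<bullet> b \<le> \<eta>"
    if b: "b \<in> Basis" for b
  proof -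
    define t where "t = ((x - a) \<bullet> b) / \<eta>"
    have t: "0 \<le> t" "t \<le> real K" "(x - a) \<bullet> b = t * \<eta>"
      using assms(3) b \<eta> by (auto simp: mem_cube t_def h field_simps)
    have "real (g b) \<le> t \<and> t \<le> real (g b) + 1"
    proof (cases "nat \<lfloor>t\<rfloor> \<le> K - 1")
      case True
      then have "g b = nat \<lfloor>t\<rfloor>" using b unfolding g_def t_def by simp
      then have "real (g b) = of_int \<lfloor>t\<rfloor>" using t(1) by simp
      then show ?thesis by linarith
    next
      case False
      then have "g b = K - 1" using b unfolding g_def t_def by simp
      then have gb: "real (g b) = real K - 1" using assms(2) by (simp add: of_nat_diff)
      have "K \<le> nat \<lfloor>t\<rfloor>" using False by simp
      then have "real K \<le> t" using t(1) assms(2) by linarith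
      then show ?thesis using gb t by simp
    qed
    then have "real (g b) * \<eta> \<le> t * \<eta>" "t * \<eta> \<le> (real (g b) + 1) * \<eta>"
      using \<eta> by (auto intro!: mult_right_mono simp del: mult_le_cancel_right)
    moreover have "(x - subcube_corner K a h g) \<bullet> b = t * \<eta> - real (g b) * \<eta>"
    proof -
      have "(\<Sum>b\<in>Basis. (real (g b) * \<eta>) *\<^sub>R b) \<bullet> b = real (g b) * \<eta>"
        using b by (simp add: inner_sum_left inner_Basis if_distrib cong: if_cong)
      then show ?thesis using t(3)
        by (simp add: subcube_corner_def \<eta>_def[symmetric] inner_diff_left inner_add_left)
    qed
    ultimately show ?thesis by (simp add: algebra_simps)
  qed
  ultimately show ?thesis by (auto simp: mem_cube \<eta>_def)
qed

text \<open>Either the ball of radius \<open>h / 4\<close> about the centre of the cube misses \<open>U\<close>, or it contains a point of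
  \<open>U\<close>, and then porosity provides a hole whose centre is within \<open>h / 4\<close> of that point, hence still
  in the cube.\<close>

lemma porous_cube_has_hole:
  fixes U :: "'a::euclidean_space set"
  assumes U: "porous c r0 U" and c: "0 < c" "c \<le> 1" and h: "0 < h" "h \<le> r0"
  shows "\<exists>z \<in> cube a h. ball z (c * h / 4) \<inter> U = {}"
proof -
  define q where "q = a + (h / 2) *\<^sub>R One"
  have near: "z \<in> cube a h" if "dist q z \<le> h / 2" for z
    unfolding mem_cube
  proof
    fix b :: 'a assume b: "b \<in> Basis"
    have "\<bar>(z - q) \<bullet> b\<bar> \<le> norm (z - q)" using b by (rule Basis_le_norm)
    then have "\<bar>(z - q) \<bullet> b\<bar> \<le> h / 2" using that by (simp add: dist_norm norm_minus_commute)
    moreover have "(z - q) \<bullet> b = (z - a) \<bullet> b - h / 2"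
      using b by (simp add: q_def inner_diff_left inner_add_left)
    ultimately show "0 \<le> (z - a) \<bullet> b \<and> (z - a) \<bullet> b \<le> h" by linarith
  qed
  show ?thesis
  proof (cases "ball q (h / 4) \<inter> U = {}")
    case True
    have "c * h / 4 \<le> h / 4" using c h by simp
    then have "ball q (c * h / 4) \<subseteq> ball q (h / 4)" by (rule subset_ball)
    then show ?thesis using True near[of q] h by (intro bexI[of _ q]) auto
  next
    case False
    then obtain x where x: "x \<in> U" "dist q x < h / 4" by auto
    moreover have "0 < h / 4" "h / 4 \<le> r0" using h by auto
    ultimately obtain z where z: "dist x z \<le> h / 4" "ball z (c * (h / 4)) \<inter> U = {}"
      using U unfolding porous_def by blast
    have "dist q z \<le> h / 2" using x(2) z(1) dist_triangle[of q z x] by linarith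
    then show ?thesis using z(2) near by auto
  qed
qed

definition cube_cover :: "nat \<Rightarrow> real \<Rightarrow> 'a::euclidean_space set \<Rightarrow> bool" where
  "cube_cover N h U \<longleftrightarrow> (\<exists>F. finite F \<and> card F \<le> N \<and> U \<subseteq> (\<Union>a\<in>F. cube a h))"

text \<open>The hole of a cube swallows the whole subcube containing its centre, because \<open>K\<close> is so large that
  the diameter of a subcube, at most \<open>d * h / K\<close>, is less than the radius \<open>c * h / 4\<close> of the hole.
  So one of the \<open>K ^ d\<close> subcubes can be discarded.\<close>

lemma cube_cover_subdivide_porous:
  fixes U :: "'a::euclidean_space set"
  assumes U: "porous c r0 U" and c: "0 < c" "c \<le> 1" and h: "0 < h" "h \<le> r0"
    and K: "4 * real DIM('a) < c * real K"
    and cov: "cube_cover N h U"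
  shows "cube_cover (N * (K ^ DIM('a) - 1)) (h / real K) U"
proof -
  have K0: "0 < K" using K c by (cases K) auto
  have one: "\<exists>G. finite G \<and> card G \<le> K ^ DIM('a) - 1 \<and> U \<inter> cube a h \<subseteq> (\<Union>a\<in>G. cube a (h / real K))"
    for a :: 'a
  proof -
    obtain z where z: "z \<in> cube a h" "ball z (c * h / 4) \<inter> U = {}"
      using porous_cube_has_hole[OF U c h] by blast
    obtain g0 where g0: "g0 \<in> subcube_index K" "z \<in> cube (subcube_corner K a h g0) (h / real K)"
      using cube_subdivision[OF h(1) K0 z(1)] by blast
    have "real DIM('a) * (h / real K) < c * h / 4"
      using mult_strict_right_mono[OF K h(1)] K0 by (simp add: field_simps)
    then have "cube (subcube_corner K a h g0) (h / real K) \<subseteq> ball z (c * h / 4)"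
      using dist_cube_le[OF g0(2)] by (metis mem_ball order_le_less_trans subsetI)
    then have hole: "cube (subcube_corner K a h g0) (h / real K) \<inter> U = {}" using z(2) by blast
    define G where "G = subcube_corner K a h ` (subcube_index K - {g0})"
    have "finite G" by (simp add: G_def finite_subcube_index)
    moreover have "card G \<le> K ^ DIM('a) - 1"
      unfolding G_def using card_image_le[of "subcube_index K - {g0}" "subcube_corner K a h"] g0(1)
      by (simp add: finite_subcube_index card_subcube_index)
    moreover have "U \<inter> cube a h \<subseteq> (\<Union>a\<in>G. cube a (h / real K))"
    proof
      fix x assume x: "x \<in> U \<inter> cube a h"
      then obtain g where g: "g \<in> subcube_index K" "x \<in> cube (subcube_corner K a h g) (h / real K)"
        using cube_subdivision[OF h(1) K0, of x a] by blast
      then have "g \<noteq> g0" using hole x by blast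
      then show "x \<in> (\<Union>a\<in>G. cube a (h / real K))" using g unfolding G_def by blast
    qed
    ultimately show ?thesis by blast
  qed
  then obtain G where G: "\<And>a. finite (G a)" "\<And>a. card (G a) \<le> K ^ DIM('a) - 1"
      "\<And>a. U \<inter> cube a h \<subseteq> (\<Union>a\<in>G a. cube a (h / real K))" by metis
  obtain F where F: "finite F" "card F \<le> N" "U \<subseteq> (\<Union>a\<in>F. cube a h)"
    using cov unfolding cube_cover_def by blast
  have "card (\<Union>a\<in>F. G a) \<le> (\<Sum>a\<in>F. card (G a))" using F(1) by (rule card_UN_le)
  also have "\<dots> \<le> (\<Sum>a\<in>F. K ^ DIM('a) - 1)" using G(2) by (intro sum_mono)
  also have "\<dots> = card F * (K ^ DIM('a) - 1)" by simp
  also have "\<dots> \<le> N * (K ^ DIM('a) - 1)" using F(2) by (rule mult_le_mono1)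
  finally have "card (\<Union>a\<in>F. G a) \<le> N * (K ^ DIM('a) - 1)" .
  moreover have "U \<subseteq> (\<Union>a\<in>(\<Union>a\<in>F. G a). cube a (h / real K))"
  proof
    fix x assume x: "x \<in> U"
    then obtain a where "a \<in> F" "x \<in> cube a h" using F(3) by blast
    then show "x \<in> (\<Union>a\<in>(\<Union>a\<in>F. G a). cube a (h / real K))" using G(3)[of a] x by blast
  qed
  ultimately show ?thesis unfolding cube_cover_def using F(1) G(1) by blast
qed

text \<open>Porosity only concerns small scales, so the iterated subdivision needs a finite cover by
  small cubes to start from.\<close>

lemma bounded_cube_cover:
  fixes U :: "'a::euclidean_space set"
  assumes "bounded U" "0 < r"
  shows "\<exists>N h. 0 < h \<and> h \<le> r \<and> cube_cover N h U"
proof -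
  obtain B where B: "0 < B" "\<And>x. x \<in> U \<Longrightarrow> norm x \<le> B"
    using assms(1) unfolding bounded_pos by blast
  have big: "U \<subseteq> cube (- B *\<^sub>R One) (2 * B)"
  proof
    fix x assume x: "x \<in> U"
    have "\<bar>x \<bullet> b\<bar> \<le> B" if "b \<in> Basis" for b
      using Basis_le_norm[OF that, of x] B(2)[OF x] by linarith
    then show "x \<in> cube (- B *\<^sub>R One) (2 * B)" unfolding mem_cube
      by (force simp: inner_diff_left inner_add_left)
  qed
  obtain L :: nat where L: "2 * B / r < real L" using reals_Archimedean2 by blast
  then have L0: "0 < L" using B(1) assms(2)
    by (intro gr0I) (auto simp: field_simps)
  have "U \<subseteq> (\<Union>a\<in>subcube_corner L (- B *\<^sub>R One) (2 * B) ` subcube_index L.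
      cube a (2 * B / real L))"
  proof
    fix x assume "x \<in> U"
    then have "x \<in> cube (- B *\<^sub>R One) (2 * B)" using big by blast
    moreover have "0 < 2 * B" using B(1) by simp
    ultimately have "\<exists>g\<in>subcube_index L.
        x \<in> cube (subcube_corner L (- B *\<^sub>R One) (2 * B) g) (2 * B / real L)"
      using cube_subdivision L0 by blast
    then show "x \<in> (\<Union>a\<in>subcube_corner L (- B *\<^sub>R One) (2 * B) ` subcube_index L.
      cube a (2 * B / real L))"
      by simp
  qed
  then have "cube_cover (card (subcube_corner L (- B *\<^sub>R One::'a) (2 * B) ` subcube_index L))
      (2 * B / real L) U"
    unfolding cube_cover_def
    by (intro exI[of _ "subcube_corner L (- B *\<^sub>R One) (2 * B) ` subcube_index L"] conjI
        finite_imageI finite_subcube_index order_refl)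
  moreover have "0 < 2 * B / real L" "2 * B / real L \<le> r"
    using B(1) L0 L assms(2) by (auto simp: field_simps)
  ultimately show ?thesis by blast
qed

text \<open>The exponent depends on \<open>c\<close> only, through \<open>K\<close>: it is chosen so that \<open>K powr s\<close> lies strictly between
  \<open>K ^ d - 1\<close> and \<open>K ^ d\<close>. The weight of the \<open>n\<close>-th subdivision is at most a constant times
  the \<open>n\<close>-th power of \<open>(K ^ d - 1) / K powr s < 1\<close>.\<close>

theorem porous_imp_hausdorff_measure_eq_0:
  assumes c: "0 < c" "c \<le> 1"
  shows "\<exists>s. 0 < s \<and> s < real DIM('a::euclidean_space) \<and>
    (\<forall>(U::'a set) r. bounded U \<and> 0 < r \<and> porous c r U \<longrightarrow> hausdorff_measure s U = 0)"
proof -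
  define d where "d = DIM('a)"
  have d: "d > 0" by (simp add: d_def)
  obtain K :: nat where K: "4 * real d / c < real K" using reals_Archimedean2 by blast
  then have Kc: "4 * real d < c * real K" using c by (simp add: field_simps)
  have "4 \<le> 4 * real d" using d by simp
  also have "\<dots> < c * real K" by (rule Kc)
  also have "\<dots> \<le> real K" using c by (simp add: mult_left_le_one_le)
  finally have K4: "4 < real K" .
  have Kd: "real K \<le> real K ^ d" using K4 d power_increasing[of 1 d "real K"] by simp
  have Kd1: "1 < real K ^ d - 1/2" using K4 Kd by linarith
  define s where "s = log (real K) (real K ^ d - 1/2)"
  have Ks: "real K powr s = real K ^ d - 1/2"
    unfolding s_def using K4 Kd1 by (intro powr_log_cancel) linarith+
  have s0: "0 < s" using K4 Kd1 by (simp add: s_def)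
  have sd: "s < real d"
  proof -
    have "s < log (real K) (real K ^ d)" unfolding s_def using K4 Kd1 by (intro log_less) linarith+
    then show ?thesis using K4 by (simp add: log_nat_power)
  qed
  define q where "q = (real K ^ d - 1) / real K powr s"
  have q: "0 \<le> q" "q < 1" unfolding q_def Ks using Kd1 by simp_all
  have "hausdorff_measure s U = 0" if U: "bounded U" "0 < r" "porous c r U" for U :: "'a set" and r
  proof (rule hausdorff_measure_eq_0_if_finite_covers[OF s0])
    fix e :: real assume e: "e > 0"
    obtain N h where h: "0 < h" "h \<le> r" and N: "cube_cover N h U"
      using bounded_cube_cover[OF U(1,2)] by blast
    have cov: "cube_cover (N * (K ^ d - 1) ^ n) (h / real K ^ n) U" for n
    proof (induction n)
      case (Suc n)
      have "h / real K ^ n \<le> h / 1" using K4 h by (intro divide_left_mono) auto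
      then show ?case
        using cube_cover_subdivide_porous[OF U(3) c _ _ Kc[unfolded d_def] Suc] h K4
        by (simp add: d_def mult_ac)
    qed (use N in simp)
    define D where "D = real d * h"
    have D: "D > 0" using h d by (simp add: D_def)
    have "(\<lambda>n. (real N * D powr s) * q ^ n) \<longlonglongrightarrow> (real N * D powr s) * 0"
      using q by (intro tendsto_mult tendsto_const LIMSEQ_power_zero) auto
    then have "\<forall>\<^sub>F n in sequentially. (real N * D powr s) * q ^ n < e"
      using e by (intro order_tendstoD) auto
    then obtain n where n: "(real N * D powr s) * q ^ n < e"
      by (auto simp: eventually_sequentially)
    obtain F where F: "finite F" "card F \<le> N * (K ^ d - 1) ^ n"
      "U \<subseteq> (\<Union>a\<in>F. cube a (h / real K ^ n))" using cov[of n] unfolding cube_cover_def by blast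
    define C where "C = (\<lambda>a. cube a (h / real K ^ n)) ` F"
    define \<delta> where "\<delta> = D / real K ^ n"
    have \<delta>s: "\<delta> powr s = D powr s / (real K powr s) ^ n"
      using D K4 by (simp add: \<delta>_def powr_divide powr_power powr_powr mult.commute flip: powr_realpow)
    have "real (card C) \<le> real (card F)" using F(1) by (simp add: C_def card_image_le)
    also have "\<dots> \<le> real (N * (K ^ d - 1) ^ n)" using F(2) by linarith
    also have "\<dots> = real N * (real K ^ d - 1) ^ n" using K4 Kd by (simp add: of_nat_diff)
    finally have "real (card C) * \<delta> powr s \<le> real N * (real K ^ d - 1) ^ n * \<delta> powr s"
      by (intro mult_right_mono) auto
    also have "\<dots> = (real N * D powr s) * q ^ n" by (simp add: \<delta>s q_def power_divide)
    finally have "real (card C) * \<delta> powr s \<le> e" using n by linarith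
    moreover have "bounded B \<and> diameter B \<le> \<delta>" if "B \<in> C" for B
    proof -
      from that obtain a where B: "B = cube a (h / real K ^ n)" by (auto simp: C_def)
      have "norm (x - y) \<le> \<delta>" if "x \<in> B" "y \<in> B" for x y
        using dist_cube_le[of x a "h / real K ^ n" y] that B
        by (simp add: dist_norm \<delta>_def D_def d_def)
      moreover have "0 \<le> \<delta>" using D by (simp add: \<delta>_def)
      ultimately show ?thesis using diameter_le[of B \<delta>] by (simp add: B cube_def)
    qed
    ultimately show "\<exists>C \<delta>. finite C \<and> U \<subseteq> \<Union> C \<and> (\<forall>B\<in>C. bounded B \<and> diameter B \<le> \<delta>) \<and>
        real (card C) * \<delta> powr s \<le> e"
      using F(1,3) by (intro exI[of _ C] exI[of _ \<delta>]) (simp add: C_def)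
  qed
  then show ?thesis using s0 sd by (auto simp: d_def)
qed

section \<open>Cardinality of sets of words\<close>

text \<open>The words over \<open>{..<m}\<close> form a compact Hausdorff space, the product of finite discrete spaces,
  whose basic neighbourhoods fix a finite prefix. The last two assumptions say in terms of prefixes
  that \<open>A\<close> is closed and has no isolated point, so \<open>A\<close> is a perfect set of this space.\<close>

lemma reals_lepoll_perfect_words:
  fixes A :: "(nat \<Rightarrow> nat) set"
  assumes A: "\<And>w i. w \<in> A \<Longrightarrow> w i < m" and ne: "A \<noteq> {}"
    and closed: "\<And>w. (\<And>n. \<exists>v\<in>A. \<forall>i<n. v i = w i) \<Longrightarrow> w \<in> A"
    and not_isolated: "\<And>w n. w \<in> A \<Longrightarrow> \<exists>v\<in>A. v \<noteq> w \<and> (\<forall>i<n. v i = w i)"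
  shows "(UNIV :: real set) \<lesssim> A"
proof -
  define X :: "(nat \<Rightarrow> nat) topology"
    where "X = product_topology (\<lambda>_. discrete_topology {..<m}) UNIV"
  have "compact_space X"
    unfolding X_def compact_space_product_topology by (simp add: compact_space_discrete_topology)
  moreover have haus: "Hausdorff_space X"
    unfolding X_def Hausdorff_space_product_topology by simp
  ultimately have "locally_compact_space X"
    by (simp add: compact_imp_locally_compact_space)
  have top: "topspace X = {w. \<forall>i. w i < m}" by (auto simp: X_def PiE_def Pi_def)
  have "X derived_set_of A = A"
  proof (intro equalityI subsetI)
    fix w assume w: "w \<in> X derived_set_of A"
    then have wm: "w i < m" for i using top by (auto simp: in_derived_set_of)
    show "w \<in> A"
    proof (rule closed)
      fix n
      let ?T = "\<Pi>\<^sub>E i\<in>UNIV. if i < n then {w i} else {..<m}"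
      have "{i. (if i < n then {w i} else {..<m}) \<noteq> {..<m}} \<subseteq> {..<n}" by auto
      then have "finite {i. (if i < n then {w i} else {..<m}) \<noteq> {..<m}}"
        by (rule finite_subset) simp
      then have "openin X ?T" unfolding X_def openin_PiE_gen using wm by auto
      moreover have "w \<in> ?T" using wm by auto
      ultimately obtain v where "v \<in> A" "v \<in> ?T"
        using w unfolding in_derived_set_of by blast
      moreover have "v i = w i" if "i < n" for i
        using PiE_mem[OF \<open>v \<in> ?T\<close>, of i] that by simp
      ultimately show "\<exists>v\<in>A. \<forall>i<n. v i = w i" by blast
    qed
  next
    fix w assume w: "w \<in> A"
    show "w \<in> X derived_set_of A"
      unfolding in_derived_set_of
    proof (intro conjI allI impI)
      show "w \<in> topspace X" using A[OF w] by (simp add: top)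
      fix T assume T: "w \<in> T \<and> openin X T"
      then obtain V where V: "finite {i. V i \<noteq> {..<m}}" "w \<in> (\<Pi>\<^sub>E i\<in>UNIV. V i)" "(\<Pi>\<^sub>E i\<in>UNIV. V i) \<subseteq> T"
        unfolding X_def openin_product_topology_alt by fastforce
      obtain n where n: "\<And>i. V i \<noteq> {..<m} \<Longrightarrow> i < n"
        using V(1) unfolding finite_nat_set_iff_bounded by auto
      obtain v where v: "v \<in> A" "v \<noteq> w" "\<And>i. i < n \<Longrightarrow> v i = w i"
        using not_isolated[OF w, of n] by blast
      have "v i \<in> V i" for i
      proof (cases "i < n")
        case True then show ?thesis using v(3) V(2) by (auto simp: PiE_iff)
      next
        case False then show ?thesis using n[of i] A[OF v(1)] by auto
      qed
      then have "v \<in> T" using V(3) by (auto simp: PiE_iff subset_eq)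
      then show "\<exists>y. y \<noteq> w \<and> y \<in> A \<and> y \<in> T" using v by blast
    qed
  qed
  then show ?thesis
    using lepoll_perfect_set[of X A] \<open>locally_compact_space X\<close> haus ne by blast
qed

lemma words_lepoll_nat_sets: "(A :: (nat \<Rightarrow> nat) set) \<lesssim> (UNIV :: nat set set)"
proof -
  define g :: "(nat \<Rightarrow> nat) \<Rightarrow> nat set" where "g w = range (\<lambda>n. prod_encode (n, w n))" for w
  have "inj g"
  proof (rule injI)
    fix v w assume "g v = g w"
    have "v n = w n" for n
    proof -
      have "prod_encode (n, v n) \<in> g w" using \<open>g v = g w\<close> unfolding g_def by blast
      then show ?thesis by (auto simp: g_def)
    qed
    then show "v = w" by (rule ext)
  qed
  then show ?thesis unfolding lepoll_def by (meson inj_on_subset subset_UNIV)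
qed

section \<open>Addresses\<close>

lemma dist_ifs_comp:
  fixes p :: "nat \<Rightarrow> 'a::real_normed_vector"
  assumes "0 \<le> lam"
  shows "dist (ifs_comp lam p w n x) (ifs_comp lam p w n y) = lam ^ n * dist x y"
  by (induction n arbitrary: x y) (simp_all add: dist_ifs_map[OF assms])

text \<open>The maps are affine bijections of the whole space. Surjectivity makes the image of a ball a full
  ball, which is how holes are transported in the proof of porosity.\<close>

lemma surj_ifs_comp: "lam \<noteq> 0 \<Longrightarrow> surj (ifs_comp lam p w n)"
proof (induction n)
  case (Suc n)
  have "ifs_map lam p j (inverse lam *\<^sub>R (x - (1 - lam) *\<^sub>R p j)) = x" for j x
    using Suc.prems by (simp add: ifs_map_def)
  then have "surj (ifs_map lam p (w n))" by (rule surjI)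
  then show ?case using Suc by (metis comp_surj ifs_comp.simps(2))
qed simp

lemma ifs_comp_cong: "(\<And>i. i < n \<Longrightarrow> w i = v i) \<Longrightarrow> ifs_comp lam p w n = ifs_comp lam p v n"
  by (induction n) auto

lemma ifs_comp_add:
  "ifs_comp lam p w (n + k) = ifs_comp lam p w n \<circ> ifs_comp lam p (\<lambda>i. w (n + i)) k"
  by (induction k) (auto simp: comp_assoc)

locale ifs_attractor =
  fixes lam :: real and p :: "nat \<Rightarrow> 'a::euclidean_space" and m :: nat and S :: "'a set"
  assumes lam: "0 < lam" "lam < 1" and attractor: "is_attractor lam p m S"
begin

lemma compact_S: "compact S" and S_ne: "S \<noteq> {}" and S_eq: "S = (\<Union>j<m. ifs_map lam p j ` S)"
  using attractor unfolding is_attractor_def by blast+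

lemma ifs_map_in: "j < m \<Longrightarrow> x \<in> S \<Longrightarrow> ifs_map lam p j x \<in> S"
  using S_eq by blast

lemma ifs_comp_in: "(\<And>i. i < n \<Longrightarrow> w i < m) \<Longrightarrow> x \<in> S \<Longrightarrow> ifs_comp lam p w n x \<in> S"
  by (induction n arbitrary: x) (auto intro: ifs_map_in)

text \<open>If \<open>w\<close> is an address of \<open>x\<close>, then \<open>x\<close> is a limit of points of the compact set
  \<open>ifs_comp lam p w n ` S\<close>, namely of images of any \<open>x0 \<in> S\<close> along longer prefixes of \<open>w\<close>. Conversely,
  if \<open>x\<close> is in all these sets, then its distance to the image of any point of the space along
  the prefix of length \<open>n\<close> is at most \<open>lam ^ n\<close> times a constant.\<close>

lemma addresses_iff:
  "w \<in> addresses lam p m x \<longleftrightarrow> (\<forall>n. w n < m) \<and> (\<forall>n. x \<in> ifs_comp lam p w n ` S)"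
proof safe
  fix n assume w: "w \<in> addresses lam p m x"
  then show wm: "w i < m" for i by (simp add: addresses_def)
  obtain x0 where x0: "x0 \<in> S" using S_ne by blast
  have "compact (ifs_comp lam p w n ` S)"
  proof (rule compact_continuous_image[OF _ compact_S])
    have "lam ^ n \<le> 1" using lam by (simp add: power_le_one)
    then have "1-lipschitz_on S (ifs_comp lam p w n)"
      using lam by (intro lipschitz_onI) (auto simp: dist_ifs_comp mult_left_le_one_le)
    then show "continuous_on S (ifs_comp lam p w n)" by (rule lipschitz_on_continuous_on)
  qed
  then have "closed (ifs_comp lam p w n ` S)" by (rule compact_imp_closed)
  moreover have "(\<lambda>k. ifs_comp lam p w (k + n) x0) \<longlonglongrightarrow> x"
    using w unfolding addresses_def by (intro LIMSEQ_ignore_initial_segment) simp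
  moreover have "ifs_comp lam p w (k + n) x0 \<in> ifs_comp lam p w n ` S" for k
    using ifs_comp_add[of lam p w n k] x0 wm by (auto simp: add.commute intro!: ifs_comp_in)
  ultimately show "x \<in> ifs_comp lam p w n ` S" by (meson closed_sequentially)
next
  assume wm: "\<forall>n. w n < m" and x: "\<forall>n. x \<in> ifs_comp lam p w n ` S"
  obtain B where B: "\<And>y. y \<in> S \<Longrightarrow> norm y \<le> B"
    using compact_imp_bounded[OF compact_S] by (auto simp: bounded_iff)
  have "(\<lambda>n. ifs_comp lam p w n x0) \<longlonglongrightarrow> x" for x0
  proof (rule metric_LIMSEQ_I, goal_cases)
    case (1 e)
    have "(\<lambda>n. lam ^ n * (norm x0 + B)) \<longlonglongrightarrow> 0 * (norm x0 + B)"
      using lam by (intro tendsto_mult tendsto_const LIMSEQ_power_zero) auto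
    then have "\<forall>\<^sub>F n in sequentially. lam ^ n * (norm x0 + B) < e"
      using 1 by (intro order_tendstoD) auto
    then obtain N where N: "\<And>n. n \<ge> N \<Longrightarrow> lam ^ n * (norm x0 + B) < e"
      by (auto simp: eventually_sequentially)
    have "dist (ifs_comp lam p w n x0) x < e" if "n \<ge> N" for n
    proof -
      obtain y where y: "y \<in> S" "x = ifs_comp lam p w n y" using x by blast
      have "dist x0 y \<le> norm x0 + B"
        using B[OF y(1)] norm_triangle_ineq4[of x0 y] by (simp add: dist_norm)
      then have "lam ^ n * dist x0 y \<le> lam ^ n * (norm x0 + B)"
        using lam by (intro mult_left_mono) auto
      then have "lam ^ n * dist x0 y < e" using N[OF that] by linarith
      then show ?thesis using lam by (simp add: y(2) dist_ifs_comp)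
    qed
    then show ?case by blast
  qed
  then show "w \<in> addresses lam p m x" using wm by (simp add: addresses_def)
qed

lemma address_exists:
  assumes x: "x \<in> S"
  shows "addresses lam p m x \<noteq> {}"
proof -
  have "\<forall>y\<in>S. \<exists>j z. j < m \<and> z \<in> S \<and> y = ifs_map lam p j z" using S_eq by blast
  then obtain J Z where JZ: "\<And>y. y \<in> S \<Longrightarrow> J y < m" "\<And>y. y \<in> S \<Longrightarrow> Z y \<in> S"
      "\<And>y. y \<in> S \<Longrightarrow> ifs_map lam p (J y) (Z y) = y"
    by metis
  \<comment> \<open>The letters are read off along the orbit of \<open>x\<close> under a choice \<open>Z\<close> of preimages.\<close>
  have orbit: "(Z ^^ n) x \<in> S" for n by (induction n) (auto intro: JZ x)
  have "ifs_comp lam p (\<lambda>n. J ((Z ^^ n) x)) n ((Z ^^ n) x) = x" for n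
    by (induction n) (simp_all add: JZ(3) orbit)
  then have "(\<lambda>n. J ((Z ^^ n) x)) \<in> addresses lam p m x"
    unfolding addresses_iff using orbit JZ(1) by (metis image_eqI)
  then show ?thesis by blast
qed

text \<open>The word is \<open>w 0, \<dots>, w (n - 1), v 0, v 1, \<dots>\<close>. By \<open>addresses_iff\<close> it suffices to see
  that \<open>ifs_comp lam p w n y\<close> is in the image of \<open>S\<close> for arbitrarily long prefixes, since these
  images decrease.\<close>

lemma prepend_word_address:
  assumes w: "\<And>i. i < n \<Longrightarrow> w i < m" and v: "v \<in> addresses lam p m y"
  shows "(\<lambda>i. if i < n then w i else v (i - n)) \<in> addresses lam p m (ifs_comp lam p w n y)"
    (is "?u \<in> _")
  unfolding addresses_iff
proof (intro conjI allI)
  have vm: "\<And>i. v i < m" and y: "\<And>k. y \<in> ifs_comp lam p v k ` S"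
    using v unfolding addresses_iff by auto
  show um: "?u k < m" for k using w vm by simp
  fix k
  obtain z where z: "z \<in> S" "y = ifs_comp lam p v k z" using y by blast
  have "ifs_comp lam p ?u n = ifs_comp lam p w n" by (rule ifs_comp_cong) simp
  moreover have "(\<lambda>i. ?u (n + i)) = v" by auto
  ultimately have "ifs_comp lam p w n y = ifs_comp lam p ?u (n + k) z"
    using z(2) by (simp only: ifs_comp_add comp_apply)
  also have "\<dots> = ifs_comp lam p ?u k (ifs_comp lam p (\<lambda>i. ?u (k + i)) n z)"
    using ifs_comp_add[of lam p ?u k n] by (simp add: add.commute)
  finally have "ifs_comp lam p w n y =
      ifs_comp lam p ?u k (ifs_comp lam p (\<lambda>i. ?u (k + i)) n z)" .
  moreover have "ifs_comp lam p (\<lambda>i. ?u (k + i)) n z \<in> S"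
    by (rule ifs_comp_in[OF um z(1)])
  ultimately show "ifs_comp lam p w n y \<in> ifs_comp lam p ?u k ` S" by (rule image_eqI)
qed

definition univoque :: "'a set" where
  "univoque = {x \<in> S. \<exists>w. addresses lam p m x = {w}}"

text \<open>The address set is closed, so if it is too small to be perfect, some address \<open>w\<close> in it is the only one
  with a certain prefix of length \<open>n\<close>. Two addresses of the point reached after these \<open>n\<close> letters
  would give two addresses of \<open>x\<close> with that prefix.\<close>

lemma few_addresses_imp_univoque_preimage:
  assumes x: "x \<in> S" and few: "addresses lam p m x \<prec> (UNIV :: nat set set)"
  shows "\<exists>w n. x \<in> ifs_comp lam p w n ` univoque"
proof -
  let ?A = "addresses lam p m x"
  have small: "\<not> (UNIV :: real set) \<lesssim> ?A"
  proof
    assume "(UNIV :: real set) \<lesssim> ?A"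
    then have "(UNIV :: nat set set) \<lesssim> ?A"
      using nat_sets_eqpoll_reals eqpoll_imp_lepoll lepoll_trans by blast
    then show False using few lesspoll_trans1 lesspoll_not_refl by blast
  qed
  have closed: "w \<in> ?A" if w: "\<And>n. \<exists>v\<in>?A. \<forall>i<n. v i = w i" for w
    unfolding addresses_iff
  proof (intro conjI allI)
    fix n
    obtain v where "v \<in> ?A" "\<forall>i<Suc n. v i = w i" using w by blast
    then show "w n < m" unfolding addresses_iff by (metis lessI)
    obtain v where v: "v \<in> ?A" "\<forall>i<n. v i = w i" using w by blast
    then have "ifs_comp lam p w n = ifs_comp lam p v n" by (intro ifs_comp_cong) auto
    then show "x \<in> ifs_comp lam p w n ` S" using v(1) unfolding addresses_iff by auto
  qed
  have "\<exists>w\<in>?A. \<exists>n. \<forall>v\<in>?A. (\<forall>i<n. v i = w i) \<longrightarrow> v = w"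
  proof (rule ccontr)
    assume "\<not> ?thesis"
    then have "\<exists>v\<in>?A. v \<noteq> w \<and> (\<forall>i<n. v i = w i)" if "w \<in> ?A" for w n using that by blast
    moreover have "w i < m" if "w \<in> ?A" for w i using that by (simp add: addresses_def)
    ultimately show False
      using reals_lepoll_perfect_words[of ?A m] address_exists[OF x] closed small by auto
  qed
  then obtain w n where w: "w \<in> ?A" and iso: "\<And>v. v \<in> ?A \<Longrightarrow> \<forall>i<n. v i = w i \<Longrightarrow> v = w"
    by blast
  have wm: "w i < m" for i using w unfolding addresses_iff by blast
  obtain y where y: "y \<in> S" "x = ifs_comp lam p w n y" using w unfolding addresses_iff by blast
  have "v = (\<lambda>i. w (n + i))" if "v \<in> addresses lam p m y" for v
  proof -
    have "(\<lambda>i. if i < n then w i else v (i - n)) = w"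
      using prepend_word_address[OF wm that] iso by (simp add: y(2))
    then show ?thesis by (metis (full_types, lifting) diff_add_inverse not_add_less1)
  qed
  then have "y \<in> univoque" using address_exists[OF y(1)] y(1) unfolding univoque_def by blast
  then show ?thesis using y(2) by blast
qed

text \<open>A composition along \<open>n\<close> letters depends on these letters only, so it is encoded by a list of naturals,
  and the lists are numbered to have a union over the naturals.\<close>

lemma exceptional_set_subset:
  "exceptional_set lam p m \<subseteq>
     (\<Union>k. ifs_comp lam p ((!) (from_nat k)) (length (from_nat k :: nat list)) ` univoque)"
proof
  fix x assume "x \<in> exceptional_set lam p m"
  then have "x \<in> S" "addresses lam p m x \<prec> (UNIV :: nat set set)"
    using attractor_unique[OF lam attractor] by (auto simp: exceptional_set_def)
  then obtain w n where x: "x \<in> ifs_comp lam p w n ` univoque"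
    using few_addresses_imp_univoque_preimage by blast
  have "ifs_comp lam p w n = ifs_comp lam p ((!) (map w [0..<n])) (length (map w [0..<n]))"
    by (auto intro: ifs_comp_cong)
  then have "x \<in> ifs_comp lam p ((!) (from_nat (to_nat (map w [0..<n]))))
      (length (from_nat (to_nat (map w [0..<n])) :: nat list)) ` univoque"
    using x by simp
  then show "x \<in> (\<Union>k. ifs_comp lam p ((!) (from_nat k)) (length (from_nat k :: nat list)) ` univoque)"
    by blast
qed

text \<open>The prefix \<open>w\<close> can be continued by \<open>j\<close> as well as by \<open>k\<close>, so there are addresses that differ at
  position \<open>n\<close>.\<close>

lemma overlap_not_univoque:
  assumes w: "\<And>i. i < n \<Longrightarrow> w i < m" and jk: "j < m" "k < m" "j \<noteq> k"
    and y: "y \<in> ifs_map lam p j ` S" "y \<in> ifs_map lam p k ` S"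
  shows "ifs_comp lam p w n y \<notin> univoque"
proof -
  have "\<exists>u \<in> addresses lam p m (ifs_comp lam p w n y). u n = l"
    if "l < m" "y \<in> ifs_map lam p l ` S" for l
  proof -
    from that(2) obtain z where z: "z \<in> S" "y = ifs_map lam p l z" by blast
    obtain v where v: "v \<in> addresses lam p m z" using address_exists[OF z(1)] by blast
    have "ifs_comp lam p (w(n := l)) n = ifs_comp lam p w n" by (rule ifs_comp_cong) auto
    then have "ifs_comp lam p (w(n := l)) (Suc n) z = ifs_comp lam p w n y" by (simp add: z(2))
    moreover have "(w(n := l)) i < m" if "i < Suc n" for i
      using that w \<open>l < m\<close> by (auto simp: less_Suc_eq)
    ultimately have "(\<lambda>i. if i < Suc n then (w(n := l)) i else v (i - Suc n))
        \<in> addresses lam p m (ifs_comp lam p w n y)"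
      using prepend_word_address[of "Suc n" "w(n := l)" v z] v by metis
    then show ?thesis by (rule bexI[rotated]) simp
  qed
  then show ?thesis using jk y unfolding univoque_def by (smt (verit) mem_Collect_eq singletonD)
qed

text \<open>Let \<open>\<rho>\<close> be the radius of a ball contained in both pieces and \<open>D\<close> a bound for the diameter of
  \<open>S\<close>. Given a scale \<open>r\<close>, the word is cut at the first \<open>n\<close> with \<open>lam ^ n * D \<le> r\<close>; then
  \<open>lam ^ n * D\<close> is at least \<open>lam * r\<close>, and the hole of radius \<open>lam ^ n * \<rho>\<close> is
  large enough.\<close>

lemma porous_univoque:
  assumes jk: "j < m" "k < m" "j \<noteq> k"
    and overlap: "interior (ifs_map lam p j ` S) \<inter> interior (ifs_map lam p k ` S) \<noteq> {}"
  shows "\<exists>c r. 0 < c \<and> c \<le> 1 \<and> 0 < r \<and> porous c r univoque"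
proof -
  obtain z0 where "z0 \<in> interior (ifs_map lam p j ` S) \<inter> interior (ifs_map lam p k ` S)"
    using overlap by blast
  then obtain \<rho> where \<rho>: "0 < \<rho>"
    "ball z0 \<rho> \<subseteq> interior (ifs_map lam p j ` S) \<inter> interior (ifs_map lam p k ` S)"
    by (metis open_Int open_interior open_contains_ball)
  then have ball: "y \<in> ifs_map lam p j ` S" "y \<in> ifs_map lam p k ` S" if "dist z0 y < \<rho>" for y
    using that interior_subset[of "ifs_map lam p j ` S"] interior_subset[of "ifs_map lam p k ` S"]
    by (auto simp: subset_eq)
  have z0: "z0 \<in> S" using ball(1)[of z0] \<rho>(1) jk(1) ifs_map_in by auto
  \<comment> \<open>The maximum makes the porosity constant at most \<open>1\<close> without comparing \<open>\<rho>\<close> and the diameter.\<close>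
  define D where "D = max \<rho> (diameter S)"
  have D: "0 < D" "\<rho> \<le> D" and dD: "dist x y \<le> D" if "x \<in> S" "y \<in> S" for x y
    using \<rho>(1) diameter_bounded_bound[OF compact_imp_bounded[OF compact_S]] that
    by (auto simp: D_def le_max_iff_disj)
  define c where "c = lam * \<rho> / D"
  have "lam * \<rho> \<le> 1 * D" using lam D[OF z0 z0] \<rho>(1) by (intro mult_mono) auto
  then have c: "0 < c" "c \<le> 1" using D[OF z0 z0] \<rho>(1) lam by (auto simp: c_def)
  have "porous c D univoque"
    unfolding porous_def
  proof (intro ballI allI impI)
    fix x r assume x: "x \<in> univoque" and r: "0 < r \<and> r \<le> D"
    obtain w where w: "w \<in> addresses lam p m x" using x unfolding univoque_def by blast
    then have wm: "w i < m" for i unfolding addresses_iff by blast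
    obtain n where n: "lam ^ n * D \<le> r" "lam * r \<le> lam ^ n * D"
    proof -
      obtain N where "lam ^ N < r / D"
        using real_arch_pow_inv[of "r / D" lam] r D[OF z0 z0] lam by auto
      then have N: "lam ^ N * D \<le> r" using D[OF z0 z0] by (simp add: field_simps)
      define n where "n = (LEAST n. lam ^ n * D \<le> r)"
      have "lam ^ n * D \<le> r" unfolding n_def using N by (rule LeastI)
      moreover have "lam * r \<le> lam ^ n * D"
      proof (cases n)
        case 0
        have "lam * r \<le> 1 * D" using lam r by (intro mult_mono) auto
        then show ?thesis by (simp add: 0)
      next
        case (Suc k)
        then have "r < lam ^ k * D"
          using not_less_Least[of k "\<lambda>n. lam ^ n * D \<le> r"] by (simp add: n_def)
        then show ?thesis using lam by (simp add: Suc mult.assoc)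
      qed
      ultimately show ?thesis by (rule that)
    qed
    define z where "z = ifs_comp lam p w n z0"
    obtain y where y: "y \<in> S" "x = ifs_comp lam p w n y" using w unfolding addresses_iff by blast
    have "dist x z = lam ^ n * dist y z0" using lam by (simp add: y(2) z_def dist_ifs_comp)
    also have "\<dots> \<le> lam ^ n * D" using dD[OF y(1) z0] lam by (intro mult_left_mono) auto
    finally have "dist x z \<le> r" using n(1) by simp
    moreover have "ball z (c * r) \<inter> univoque = {}"
    proof -
      have "y' \<notin> univoque" if y': "dist z y' < c * r" for y'
      proof -
        obtain y0 where y0: "y' = ifs_comp lam p w n y0"
          using surj_ifs_comp[of lam p w n] lam by (metis less_irrefl surjD)
        have "c * r = \<rho> / D * (lam * r)" by (simp add: c_def)
        also have "\<dots> \<le> \<rho> / D * (lam ^ n * D)"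
          using n(2) \<rho>(1) D[OF z0 z0] by (intro mult_left_mono) auto
        also have "\<dots> = lam ^ n * \<rho>" using D[OF z0 z0] by simp
        finally have "c * r \<le> lam ^ n * \<rho>" .
        moreover have "lam ^ n * dist z0 y0 < c * r"
          using y' lam by (simp add: y0 z_def dist_ifs_comp)
        ultimately have "lam ^ n * dist z0 y0 < lam ^ n * \<rho>" by (rule less_le_trans[rotated])
        then have "dist z0 y0 < \<rho>" using lam by simp
        then show ?thesis unfolding y0 by (intro overlap_not_univoque[OF wm jk] ball)
      qed
      then show ?thesis by (auto simp: disjoint_iff)
    qed
    ultimately show "\<exists>z. dist x z \<le> r \<and> ball z (c * r) \<inter> univoque = {}" by blast
  qed
  then show ?thesis using c D[OF z0 z0] by blast
qed

lemma overlap_imp_exceptional_set_null: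
  assumes jk: "j < m" "k < m" "j \<noteq> k"
    and overlap: "interior (ifs_map lam p j ` S) \<inter> interior (ifs_map lam p k ` S) \<noteq> {}"
  shows "\<exists>s. 0 < s \<and> s < real DIM('a) \<and> hausdorff_measure s (exceptional_set lam p m) = 0"
proof -
  obtain c r where c: "0 < c" "c \<le> 1" and r: "0 < r" "porous c r univoque"
    using porous_univoque[OF assms] by blast
  obtain s where s: "0 < s" "s < real DIM('a)"
    and "\<And>(U::'a set) r. bounded U \<Longrightarrow> 0 < r \<Longrightarrow> porous c r U \<Longrightarrow> hausdorff_measure s U = 0"
    using porous_imp_hausdorff_measure_eq_0[OF c] by blast
  moreover have "bounded univoque"
    using compact_imp_bounded[OF compact_S] by (rule bounded_subset) (auto simp: univoque_def)
  ultimately have U: "hausdorff_measure s univoque = 0" using r by blast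
  have "hausdorff_measure s (ifs_comp lam p w n ` univoque) = 0" for w n
  proof (rule hausdorff_measure_eq_0_image[OF s(1) U])
    have "lam ^ n \<le> 1" using lam by (simp add: power_le_one)
    then show "dist (ifs_comp lam p w n x) (ifs_comp lam p w n y) \<le> dist x y" for x y
      using lam by (simp add: dist_ifs_comp mult_left_le_one_le)
  qed
  then have "hausdorff_measure s (exceptional_set lam p m) = 0"
    by (intro hausdorff_measure_eq_0_subset[OF s(1) _ exceptional_set_subset]
        hausdorff_measure_eq_0_UN s(1))
  then show ?thesis using s by blast
qed

end

text \<open>In full dimension the relative interior is the interior, and a nonempty convex set has a nonempty
  relative interior.\<close>

lemma interior_ifs_map_hull_nonempty:
  fixes p :: "nat \<Rightarrow> 'a::euclidean_space"
  assumes "lam \<noteq> 0" "aff_dim (hull_points p m) = int DIM('a)"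
  shows "convex (ifs_map lam p k ` hull_points p m)"
    and "interior (ifs_map lam p k ` hull_points p m) \<noteq> {}"
proof -
  have eq: "ifs_map lam p k ` hull_points p m =
      (+) ((1 - lam) *\<^sub>R p k) ` ((*\<^sub>R) lam ` hull_points p m)"
    by (auto simp: ifs_map_def image_image add.commute)
  have conv: "convex (hull_points p m)" by (simp add: hull_points_def)
  then show cv: "convex (ifs_map lam p k ` hull_points p m)"
    unfolding eq by (intro convex_translation convex_scaling)
  have "aff_dim (ifs_map lam p k ` hull_points p m) = int DIM('a)"
    unfolding eq aff_dim_translation_eq using assms
    by (subst aff_dim_injective_linear_image) (auto simp: injective_scaleR linear_scaleR)
  then show "interior (ifs_map lam p k ` hull_points p m) \<noteq> {}"
    using interior_rel_interior[of "ifs_map lam p k ` hull_points p m"] rel_interior_eq_empty[OF cv]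
    by (cases "ifs_map lam p k ` hull_points p m = {}") (simp_all add: aff_dim_empty)
qed

theorem theorem3p5:
  fixes p :: "nat \<Rightarrow> 'a::euclidean_space" and m :: nat and lam :: real
  assumes "inj_on p {..<m}"
    and "aff_dim (hull_points p m) = int DIM('a)"
    and "0 < lam" and "lam < 1"
    and "attractor lam p m = hull_points p m"
    and "\<exists>i<m. \<exists>k<m. \<exists>v. v extreme_point_of (ifs_map lam p k ` hull_points p m) \<and>
           v \<in> interior (ifs_map lam p i ` hull_points p m)"
  shows "(AE x in lebesgue. x \<in> hull_points p m \<longrightarrow>
            addresses lam p m x \<approx> (UNIV :: nat set set)) \<and>
         hausdorff_dim (exceptional_set lam p m) < ereal (real DIM('a))"
proof -
  let ?S = "hull_points p m"
  obtain i k v where ik: "i < m" "k < m" and v: "v extreme_point_of (ifs_map lam p k ` ?S)"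
      "v \<in> interior (ifs_map lam p i ` ?S)"
    using assms(6) by blast
  have "i \<noteq> k" using extreme_point_not_in_interior[OF v(1)] v(2) by blast
  interpret ifs_attractor lam p m ?S
    using assms(3,4,5) is_attractor_attractor[of lam m p] ik(1)
    by unfold_locales (auto simp del: not_gr_zero)
  \<comment> \<open>A vertex of a convex body is a limit of its interior points, so the interiors overlap.\<close>
  have "v \<in> closure (interior (ifs_map lam p k ` ?S))"
    using v(1) interior_ifs_map_hull_nonempty[of lam p m k] assms(2,3)
      closure_subset[of "ifs_map lam p k ` ?S"]
    by (auto simp: convex_closure_interior extreme_point_of_def)
  then have "interior (ifs_map lam p i ` ?S) \<inter> interior (ifs_map lam p k ` ?S) \<noteq> {}"
    using v(2) open_Int_closure_eq_empty[OF open_interior] by blast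
  then obtain s where s: "0 < s" "s < real DIM('a)"
      "hausdorff_measure s (exceptional_set lam p m) = 0"
    using overlap_imp_exceptional_set_null[OF ik \<open>i \<noteq> k\<close>] by blast
  have "hausdorff_dim (exceptional_set lam p m) \<le> ereal s"
    using s by (intro hausdorff_dim_le) auto
  also have "\<dots> < ereal (real DIM('a))" using s by simp
  finally have dim: "hausdorff_dim (exceptional_set lam p m) < ereal (real DIM('a))" .
  have "negligible (exceptional_set lam p m)"
    using s by (intro negligible_if_hausdorff_measure_eq_0[of s]) auto
  then have "AE x in lebesgue. x \<notin> exceptional_set lam p m"
    by (intro AE_not_in) (simp add: negligible_iff_null_sets)
  then have "AE x in lebesgue. x \<in> ?S \<longrightarrow> addresses lam p m x \<approx> (UNIV :: nat set set)"
  proof eventually_elim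
    case (elim x)
    then show ?case using words_lepoll_nat_sets[of "addresses lam p m x"] assms(5)
      by (auto simp: exceptional_set_def lesspoll_def)
  qed
  then show ?thesis using dim by blast
qed

end
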